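(* Let $h$ be a fixed positive integer and let $$S(x;h):=\sum_{1\le n\le x,\ n\neq h} d(n)\,d(n-h)\,d(n+h).$$ Then, as $x\to\infty$, $$S(x;h)\ \ge\ \frac{c_h}{27}\,x(\log x)^3+O_h\big(x(\log x)^2\big),$$ where $$c_h:=\frac{11}{8}\,f(h)\prod_{p}\Big(1-\frac1p\Big)^2\Big(1+\frac2p\Big),$$ the product running over all primes $p$, and $f$ is the multiplicative function with $f(1)=1$ and, for primes $p$ and integers $\nu\ge1$, $$f(p^\nu)=\begin{cases}\left(1+\frac4p+\frac1{p^2}-\frac{3\nu+4}{p^{\nu+1}}-\frac4{p^{\nu+2}}+\frac{3\nu+2}{p^{\nu+3}}\right)\left(1+\frac2p\right)^{-1}\left(1-\frac1p\right)^{-2}, & p>2,\\[2mm] \frac{52}{11}-\frac{41+15\nu}{11\cdot 2^{\nu}}, & p=2.\end{cases}$$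
   Context: For a nonzero integer $m$, $d(m)$ denotes the number of positive divisors of $m$ (so $d(m)=d(|m|)$). The implied constant in $O_h$ may depend on $h$. *)

theory Defs
  imports "HOL-Analysis.Analysis" "HOL-Computational_Algebra.Primes"
begin

definition dcount :: "int \<Rightarrow> nat" where
  "dcount m = card {k::nat. 0 < k \<and> k dvd nat \<bar>m\<bar>}"

definition S_sum :: "real \<Rightarrow> int \<Rightarrow> real" where
  "S_sum x h = (\<Sum>n \<in> {n::int. 1 \<le> n \<and> real_of_int n \<le> x \<and> n \<noteq> h}.
      real (dcount n) * real (dcount (n - h)) * real (dcount (n + h)))"

definition f_pp :: "nat \<Rightarrow> nat \<Rightarrow> real" where
  "f_pp p \<nu> =
    (if p = 2 then 52/11 - (41 + 15 * real \<nu>) / (11 * 2 ^ \<nu>)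
     else (1 + 4/real p + 1/real p^2 - (3*real \<nu> + 4)/real p^(\<nu>+1)
             - 4/real p^(\<nu>+2) + (3*real \<nu> + 2)/real p^(\<nu>+3))
          / (1 + 2/real p) / (1 - 1/real p)^2)"

definition f_mult :: "nat \<Rightarrow> real" where
  "f_mult n = (\<Prod>p\<in>prime_factors n. f_pp p (multiplicity p n))"

definition euler_const :: real where
  "euler_const = (\<Prod>p. if prime p then (1 - 1/real p)^2 * (1 + 2/real p) else 1)"

definition c_h :: "nat \<Rightarrow> real" where
  "c_h h = 11/8 * f_mult h * euler_const"

end

theory Submission
  imports Defs "HOL-Real_Asymp.Real_Asymp"
begin

text \<open>
  If \<open>m > Y\<^sup>2\<close>, divisors of \<open>m\<close> pair up so that \<open>d(m)\<close> is at least twice the number of divisors up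
  to \<open>Y\<close>. With \<open>Y \<approx> x\<^bsup>1/3\<^esup>\<close>, all but \<open>O(Y\<^sup>2)\<close> of the terms of \<open>S(x;h)\<close> are thus bounded below by 8 times the
  number of triples \<open>(a,b,c)\<close> in \<open>{1..Y}\<^sup>3\<close> with \<open>a | n\<close>, \<open>b | n - h\<close>, \<open>c | n + h\<close>. For a given triple, these \<open>n\<close> form
  a residue class modulo \<open>lcm(a,b,c)\<close> as soon as \<open>gcd(a,b) | h\<close>, \<open>gcd(a,c) | h\<close> and \<open>gcd(b,c) | 2h\<close>. So it remains
  to bound the sum of \<open>1/lcm(a,b,c)\<close> over such triples from below.

  The factor 8 is more than is needed, so that constant factors may be lost. Fix \<open>P \<ge> max(2h, 6)\<close>. Take only
  triples that are a product of a triple built from primes up to \<open>P\<close> with bounded exponents and a pairwise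
  coprime triple without prime factors up to \<open>P\<close>. The first part contributes a product of truncated local
  sums, computed exactly; the second, with entries up to \<open>z\<close>, is at least \<open>1 - 3/P\<close> times the cube of
  \<open>log z \<cdot> \<Prod>\<^bsub>p \<le> P\<^esub> (1 - 1/p)\<close>, by a union bound over primes \<open>p > P\<close>. The local densities for \<open>p \<le> P\<close> multiply to
  at least \<open>c_h\<close> because the factors of the Euler product are at most 1.
\<close>

subsection \<open>Counting solutions of the divisibility conditions\<close>

text \<open>The residues prescribed for \<open>n\<close> modulo \<open>a\<close>, \<open>b\<close>,
  \<open>c\<close> are 0, \<open>h\<close>, \<open>-h\<close>. Each gcd has to divide the difference
  of the two residues concerned.\<close>

definition compatible :: "nat \<Rightarrow> nat \<times> nat \<times> nat \<Rightarrow> bool" where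
  "compatible h = (\<lambda>(a, b, c). gcd a b dvd h \<and> gcd a c dvd h \<and> gcd b c dvd 2 * h)"

definition lcm3 :: "nat \<times> nat \<times> nat \<Rightarrow> nat" where
  "lcm3 = (\<lambda>(a, b, c). lcm a (lcm b c))"

text \<open>A multiple of Bezout's identity splits \<open>r - s\<close> into a multiple of
  \<open>a\<close> plus a multiple of \<open>b\<close>.\<close>

lemma binary_crt_gcd_dvd:
  fixes a b r s :: int
  assumes "gcd a b dvd r - s"
  shows "\<exists>n. a dvd n - r \<and> b dvd n - s"
proof -
  obtain u v where uv: "u * a + v * b = gcd a b"
    using bezout_int by blast
  obtain k where k: "r - s = gcd a b * k"
    using assms by blast
  have "(r - u * a * k) - s = b * (v * k)"
    using k uv[symmetric] by (simp add: algebra_simps)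
  moreover have "(r - u * a * k) - r = a * (- u * k)"
    by (simp add: algebra_simps)
  ultimately show ?thesis
    by (metis dvd_triv_left)
qed

text \<open>The conditions modulo \<open>a\<close> and \<open>b\<close> are merged into one modulo
  their lcm, then joined with the one modulo \<open>c\<close>. The second step is solvable because
  gcd distributes over lcm.\<close>

lemma compatible_imp_solution:
  assumes "compatible h (a, b, c)"
  shows "\<exists>n. int a dvd n \<and> int b dvd n - int h \<and> int c dvd n + int h"
proof -
  have ab: "gcd (int a) (int b) dvd int h" and ac: "gcd (int a) (int c) dvd int h"
    and bc: "gcd (int b) (int c) dvd 2 * int h"
    using assms int_dvd_int_iff[of "gcd b c" "2 * h"]
    by (simp_all add: compatible_def flip: int_dvd_int_iff)
  obtain m where m: "int a dvd m" "int b dvd m - int h"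
    using binary_crt_gcd_dvd[of "int a" "int b" 0 "int h"] ab by auto
  have "gcd (int a) (int c) dvd m + int h"
    using ac m(1) by (meson dvd_add dvd_trans gcd_dvd1)
  moreover have "gcd (int b) (int c) dvd (m - int h) + 2 * int h"
    using bc m(2) by (meson dvd_add dvd_trans gcd_dvd1)
  hence "gcd (int b) (int c) dvd m + int h"
    by (simp add: algebra_simps)
  ultimately have "lcm (gcd (int a) (int c)) (gcd (int b) (int c)) dvd m + int h"
    by (rule lcm_least)
  hence "gcd (lcm (int a) (int b)) (int c) dvd m - (- int h)"
    using gcd_lcm_distrib[of "int c" "int a" "int b"] by (simp add: gcd.commute)
  then obtain n where n: "lcm (int a) (int b) dvd n - m" "int c dvd n - (- int h)"
    using binary_crt_gcd_dvd by blast
  have "int a dvd (n - m) + m" "int b dvd (n - m) + (m - int h)"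
    using n m by (meson dvd_add dvd_trans dvd_lcm1 dvd_lcm2)+
  thus ?thesis
    using n(2) by (intro exI[of _ n]) simp
qed

text \<open>With \<open>u\<close> and \<open>v\<close> the floors of \<open>(A - r) / L\<close> and
  \<open>(B - r) / L\<close>, every \<open>r + L * t\<close> with \<open>u < t \<le> v\<close>
  qualifies, and \<open>v - u\<close> exceeds \<open>(B - A) / L - 1\<close>.\<close>

lemma card_residue_class_ge:
  fixes L r A B :: int
  assumes "L > 0"
  shows "(B - A) / L - 1 \<le> card {n \<in> {A<..B}. L dvd n - r}"
proof -
  define u v where "u = (A - r) div L" and "v = (B - r) div L"
  have u: "real_of_int u \<le> (A - r) / L" and v: "(B - r) / L - 1 < real_of_int v"
    unfolding u_def v_def floor_divide_of_int_eq[where 'a = real, symmetric] by linarith+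
  have "(\<lambda>t. r + L * t) ` {u<..v} \<subseteq> {n \<in> {A<..B}. L dvd n - r}"
  proof safe
    fix t assume t: "t \<in> {u<..v}"
    have "A - r < t * L"
    proof -
      have "A - r = u * L + (A - r) mod L"
        by (simp add: u_def)
      also have "\<dots> < (u + 1) * L"
        using assms by (simp add: algebra_simps)
      also have "\<dots> \<le> t * L"
        using t assms by (intro mult_right_mono) auto
      finally show ?thesis .
    qed
    moreover have "t * L \<le> B - r"
    proof -
      have "t * L \<le> v * L"
        using t assms by (intro mult_right_mono) auto
      also have "\<dots> \<le> v * L + (B - r) mod L"
        using assms by simp
      also have "\<dots> = B - r"
        by (simp add: v_def)
      finally show ?thesis .
    qed
    ultimately show "r + L * t \<in> {A<..B}"
      by (simp add: algebra_simps)
  qed simp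
  hence "card ((\<lambda>t. r + L * t) ` {u<..v}) \<le> card {n \<in> {A<..B}. L dvd n - r}"
    by (intro card_mono) (rule finite_subset[of _ "{A<..B}"], auto)
  moreover have "card ((\<lambda>t. r + L * t) ` {u<..v}) = card {u<..v}"
    using assms by (intro card_image) (auto simp: inj_on_def)
  ultimately have "v - u \<le> card {n \<in> {A<..B}. L dvd n - r}"
    by simp
  hence "real_of_int v - real_of_int u \<le> card {n \<in> {A<..B}. L dvd n - r}"
    by linarith
  moreover have "(B - A) / L = (B - r) / L - (A - r) / L"
    by (simp add: diff_divide_distrib)
  ultimately show ?thesis
    using u v by linarith
qed

definition hits :: "nat \<Rightarrow> int \<Rightarrow> nat \<times> nat \<times> nat \<Rightarrow> bool" where
  "hits h n = (\<lambda>(a, b, c). int a dvd n \<and> int b dvd n - int h \<and> int c dvd n + int h)"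

lemma card_hits_ge:
  fixes A B :: int
  assumes "compatible h t" "lcm3 t > 0"
  shows "(B - A) / lcm3 t - 1 \<le> card {n \<in> {A<..B}. hits h n t}"
proof -
  obtain a b c where t: "t = (a, b, c)"
    by (cases t)
  obtain r where r: "int a dvd r" "int b dvd r - int h" "int c dvd r + int h"
    using compatible_imp_solution assms(1) unfolding t by blast
  have "{n \<in> {A<..B}. int (lcm3 t) dvd n - r} \<subseteq> {n \<in> {A<..B}. hits h n t}"
  proof safe
    fix n assume n: "int (lcm3 t) dvd n - r"
    have "int a dvd n - r" "int b dvd n - r" "int c dvd n - r"
      using n by (auto simp: t lcm3_def simp flip: lcm_int_int_eq)
    hence "int a dvd (n - r) + r" "int b dvd (n - r) + (r - int h)" "int c dvd (n - r) + (r + int h)"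
      using r by (meson dvd_add)+
    thus "hits h n t"
      by (simp add: t hits_def algebra_simps)
  qed
  hence "card {n \<in> {A<..B}. int (lcm3 t) dvd n - r} \<le> card {n \<in> {A<..B}. hits h n t}"
    by (intro card_mono) (rule finite_subset[of _ "{A<..B}"], auto)
  thus ?thesis
    using card_residue_class_ge[of "int (lcm3 t)" B A r] assms(2) by simp
qed

text \<open>Every divisor at most \<open>Y\<close> has a complementary divisor exceeding \<open>Y\<close>.\<close>

lemma dcount_ge_twice_small_divisors:
  assumes "m > int (Y ^ 2)"
  shows "2 * card {a \<in> {1..Y}. int a dvd m} \<le> dcount m"
proof -
  define M where "M = nat \<bar>m\<bar>"
  define S where "S = {a \<in> {1..Y}. a dvd M}"
  define D where "D = {k. 0 < k \<and> k dvd M}"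
  have S_eq: "{a \<in> {1..Y}. int a dvd m} = S"
    by (auto simp: S_def M_def simp flip: int_dvd_int_iff)
  have M: "M > Y * Y"
    using assms unfolding M_def power2_eq_square by linarith
  have big: "M div a > Y" if "a \<in> S" for a
  proof -
    have "a * (M div a) = M"
      using that by (simp add: S_def)
    moreover have "a \<le> Y"
      using that by (simp add: S_def)
    ultimately show ?thesis
      using M by (metis leI mult_le_mono leD)
  qed
  have inj: "inj_on (\<lambda>a. M div a) S"
  proof (rule inj_onI)
    fix a b assume ab: "a \<in> S" "b \<in> S" "M div a = M div b"
    have "a * (M div a) = b * (M div b)"
      using ab(1,2) by (simp add: S_def)
    thus "a = b"
      using ab(3) big[OF ab(2)] by simp
  qed
  have finD: "finite D"
    using M finite_divisors_nat[of M] unfolding D_def by (auto intro: rev_finite_subset)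
  have "S \<inter> (\<lambda>a. M div a) ` S = {}"
  proof -
    have "a \<noteq> M div b" if "a \<in> S" "b \<in> S" for a b
      using big[OF that(2)] that(1) by (simp add: S_def)
    thus ?thesis
      by blast
  qed
  hence "card (S \<union> (\<lambda>a. M div a) ` S) = card S + card S"
    using inj by (simp add: card_Un_disjoint card_image S_def)
  moreover have "S \<union> (\<lambda>a. M div a) ` S \<subseteq> D"
  proof -
    have "M div a \<in> D" "a \<in> D" if "a \<in> S" for a
      using big[OF that] that by (auto simp: S_def D_def div_dvd_iff_mult)
    thus ?thesis
      by blast
  qed
  hence "card (S \<union> (\<lambda>a. M div a) ` S) \<le> card D"
    using finD card_mono by blast
  ultimately show ?thesis
    unfolding S_eq by (simp add: dcount_def D_def M_def)
qed

text \<open>Each of the three divisor counts is at least twice the number of divisors up to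
  \<open>Y\<close>, which gives the 8. Exchanging summation over \<open>n\<close> and triples leaves
  residue class counts. The term \<open>- x\<close> pays for the loss of 1 per triple, there being
  at most \<open>Y ^ 3\<close> triples.\<close>

lemma S_sum_ge:
  fixes x :: real
  assumes T: "T \<subseteq> {1..Y} \<times> {1..Y} \<times> {1..Y}" "\<forall>t\<in>T. compatible h t"
    and Y: "real Y ^ 3 \<le> x"
  shows "8 * ((x - 1 - real h - real Y ^ 2) * (\<Sum>t\<in>T. 1 / lcm3 t) - x) \<le> S_sum x (int h)"
proof -
  \<comment> \<open>Beyond \<open>A\<close> even the smallest argument \<open>n - h\<close> exceeds
    \<open>Y ^ 2\<close>; this also excludes \<open>n = h\<close>.\<close>
  define A B where "A = int h + int (Y ^ 2)" and "B = \<lfloor>x\<rfloor>"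
  define w where "w = (\<lambda>n. real (dcount n) * real (dcount (n - int h)) * real (dcount (n + int h)))"
  have finT: "finite T"
    using T(1) finite_subset by blast
  have pos: "lcm3 t > 0" if "t \<in> T" for t
    using that T(1) by (auto simp: lcm3_def lcm_pos_nat)
  have w: "8 * real (card {t \<in> T. hits h n t}) \<le> w n" if n: "n \<in> {A<..B}" for n
  proof -
    define d where "d = (\<lambda>m. {a \<in> {1..Y}. int a dvd m})"
    have "{t \<in> T. hits h n t} \<subseteq> d n \<times> d (n - int h) \<times> d (n + int h)"
      using T(1) by (auto simp: hits_def d_def)
    hence "card {t \<in> T. hits h n t} \<le> card (d n \<times> d (n - int h) \<times> d (n + int h))"
      by (intro card_mono) (auto simp: d_def)
    also have "\<dots> = card (d n) * (card (d (n - int h)) * card (d (n + int h)))"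
      by (simp add: card_cartesian_product)
    finally have "8 * card {t \<in> T. hits h n t}
        \<le> (2 * card (d n)) * ((2 * card (d (n - int h))) * (2 * card (d (n + int h))))"
      by simp
    also have "\<dots> \<le> dcount n * (dcount (n - int h) * dcount (n + int h))"
      unfolding d_def using n
      by (intro mult_le_mono dcount_ge_twice_small_divisors) (auto simp: A_def)
    finally have "real (8 * card {t \<in> T. hits h n t}) \<le> real (dcount n * (dcount (n - int h) * dcount (n + int h)))"
      by (simp only: of_nat_le_iff)
    thus ?thesis
      by (simp add: w_def mult.assoc)
  qed
  have "real (card T) \<le> x"
  proof -
    have "card T \<le> card ({1..Y} \<times> {1..Y} \<times> {1..Y})"
      using T(1) by (intro card_mono) auto
    also have "\<dots> = Y ^ 3"
      by (simp add: card_cartesian_product power3_eq_cube)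
    finally have "real (card T) \<le> real (Y ^ 3)"
      by (simp only: of_nat_le_iff)
    thus ?thesis
      using Y by (simp only: of_nat_power)
  qed
  moreover have "x - 1 - real h - real Y ^ 2 \<le> B - A"
    unfolding A_def B_def by simp
  hence "(x - 1 - real h - real Y ^ 2) * (\<Sum>t\<in>T. 1 / lcm3 t) \<le> (B - A) * (\<Sum>t\<in>T. 1 / lcm3 t)"
    by (intro mult_right_mono sum_nonneg) auto
  ultimately have "(x - 1 - real h - real Y ^ 2) * (\<Sum>t\<in>T. 1 / lcm3 t) - x
      \<le> (B - A) * (\<Sum>t\<in>T. 1 / lcm3 t) - real (card T)"
    by linarith
  also have "\<dots> = (\<Sum>t\<in>T. (B - A) / lcm3 t - 1)"
    by (simp add: sum_subtractf sum_distrib_left)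
  also have "\<dots> \<le> (\<Sum>t\<in>T. real (card {n \<in> {A<..B}. hits h n t}))"
    using T(2) pos by (intro sum_mono card_hits_ge) auto
  also have "\<dots> = (\<Sum>t\<in>T. \<Sum>n | n \<in> {A<..B} \<and> hits h n t. 1)"
    by simp
  also have "\<dots> = (\<Sum>n\<in>{A<..B}. \<Sum>t | t \<in> T \<and> hits h n t. 1)"
    using finT by (intro sum.swap_restrict) auto
  also have "\<dots> = (\<Sum>n\<in>{A<..B}. real (card {t \<in> T. hits h n t}))"
    by simp
  finally have "8 * ((x - 1 - real h - real Y ^ 2) * (\<Sum>t\<in>T. 1 / lcm3 t) - x)
      \<le> (\<Sum>n\<in>{A<..B}. 8 * real (card {t \<in> T. hits h n t}))"
    unfolding sum_distrib_left[symmetric] by (rule mult_left_mono) simp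
  also have "\<dots> \<le> (\<Sum>n\<in>{A<..B}. w n)"
    using w by (intro sum_mono)
  also have "\<dots> \<le> (\<Sum>n | 1 \<le> n \<and> real_of_int n \<le> x \<and> n \<noteq> int h. w n)"
  proof (rule sum_mono2)
    show "finite {n. 1 \<le> n \<and> real_of_int n \<le> x \<and> n \<noteq> int h}"
      by (rule finite_subset[of _ "{1..B}"]) (auto simp: B_def le_floor_iff)
    show "{A<..B} \<subseteq> {n. 1 \<le> n \<and> real_of_int n \<le> x \<and> n \<noteq> int h}"
    proof
      fix n assume n: "n \<in> {A<..B}"
      have "A \<ge> int h" by (simp add: A_def)
      thus "n \<in> {n. 1 \<le> n \<and> real_of_int n \<le> x \<and> n \<noteq> int h}"
        using n by (auto simp: B_def le_floor_iff)
    qed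
  qed (simp add: w_def)
  finally show ?thesis
    by (simp add: S_sum_def w_def)
qed

subsection \<open>Numbers without small prime factors\<close>

text \<open>The set of forbidden primes is arbitrary, so that they can be added or removed one at a
  time by induction.\<close>

definition rough :: "nat set \<Rightarrow> nat \<Rightarrow> nat set" where
  "rough Q z = {n \<in> {1..z}. \<forall>p\<in>Q. \<not> p dvd n}"

lemma finite_rough [simp]: "finite (rough Q z)"
  by (simp add: rough_def)

text \<open>Division by \<open>p\<close> sends the multiples of \<open>p\<close> injectively into
  the same rough set, and each weight picks up a factor \<open>1 / p\<close>.\<close>

lemma sum_rough_multiples_le:
  assumes "p > 0"
  shows "(\<Sum>n\<in>rough Q z. of_bool (p dvd n) / real n) \<le> (\<Sum>n\<in>rough Q z. 1 / real n) / real p"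
proof -
  have sub: "{n \<in> rough Q z. p dvd n} \<subseteq> (\<lambda>m. p * m) ` rough Q z"
  proof safe
    fix n assume n: "n \<in> rough Q z" "p dvd n"
    then obtain m where m: "n = p * m" by blast
    have "m \<le> p * m"
      using assms by simp
    moreover have "p * m \<le> z"
      using n(1) by (simp add: rough_def m)
    ultimately have "m \<le> z"
      by (rule order_trans)
    hence "m \<in> rough Q z"
      using n(1) by (auto simp: rough_def m)
    thus "n \<in> (\<lambda>m. p * m) ` rough Q z"
      using m by blast
  qed
  have "(\<Sum>n\<in>rough Q z. of_bool (p dvd n) / real n) = (\<Sum>n | n \<in> rough Q z \<and> p dvd n. 1 / real n)"
    by (intro sum.mono_neutral_cong_right) auto
  also have "\<dots> \<le> (\<Sum>n\<in>(\<lambda>m. p * m) ` rough Q z. 1 / real n)"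
    using sub by (intro sum_mono2) auto
  also have "\<dots> = (\<Sum>m\<in>rough Q z. 1 / real (p * m))"
    using assms by (subst sum.reindex) (auto simp: inj_on_def)
  also have "\<dots> = (\<Sum>n\<in>rough Q z. 1 / real n) / real p"
    by (simp add: sum_divide_distrib mult.commute)
  finally show ?thesis .
qed

text \<open>Forbidding one more prime \<open>p\<close> removes at most the fraction
  \<open>1 / p\<close> of the sum. The induction starts from the harmonic sum.\<close>

lemma sum_rough_ge:
  assumes "finite Q" "\<forall>p\<in>Q. prime p"
  shows "(\<Prod>p\<in>Q. 1 - 1 / real p) * ln (real z + 1) \<le> (\<Sum>n\<in>rough Q z. 1 / real n)"
  using assms
proof (induction Q rule: finite_induct)
  case empty
  have "(\<Sum>n\<in>rough {} z. 1 / real n) = harm z"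
    by (simp add: rough_def harm_def inverse_eq_divide atLeastAtMost_def atLeast_def atMost_def Int_def)
  thus ?case
    using ln_le_harm[of z] by simp
next
  case (insert p Q)
  have p: "real p > 1"
    using insert.prems prime_gt_1_nat by auto
  have "(\<Prod>q\<in>insert p Q. 1 - 1 / real q) * ln (real z + 1)
      = (1 - 1 / real p) * ((\<Prod>q\<in>Q. 1 - 1 / real q) * ln (real z + 1))"
    using insert.hyps by simp
  also have "\<dots> \<le> (1 - 1 / real p) * (\<Sum>n\<in>rough Q z. 1 / real n)"
    using insert p by (intro mult_left_mono) auto
  also have "\<dots> \<le> (\<Sum>n\<in>rough Q z. 1 / real n) - (\<Sum>n\<in>rough Q z. of_bool (p dvd n) / real n)"
    using sum_rough_multiples_le[of p Q z] p by (simp add: algebra_simps)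
  also have "\<dots> = (\<Sum>n\<in>rough Q z. (1 - of_bool (p dvd n)) / real n)"
    by (simp add: sum_subtractf diff_divide_distrib)
  also have "\<dots> = (\<Sum>n\<in>rough (insert p Q) z. 1 / real n)"
    by (intro sum.mono_neutral_cong_right) (auto simp: rough_def)
  finally show ?case .
qed

lemma sum_inverse_squares_le:
  assumes "P > 0"
  shows "(\<Sum>n\<in>{P<..z}. 1 / real n ^ 2) \<le> 1 / real P"
proof (cases "P \<le> z")
  case True
  \<comment> \<open>The extra \<open>- 1 / real z\<close> makes the bound telescope.\<close>
  hence "(\<Sum>n\<in>{P<..z}. 1 / real n ^ 2) \<le> 1 / real P - 1 / real z"
  proof (induction z rule: dec_induct)
    case (step n)
    have "{P<..Suc n} = insert (Suc n) {P<..n}"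
      using step by auto
    moreover have "1 / real (Suc n) ^ 2 \<le> 1 / real n - 1 / real (Suc n)"
    proof -
      have "1 / real (Suc n) ^ 2 \<le> 1 / (real n * real (Suc n))"
        using step assms by (intro divide_left_mono) (auto simp: power2_eq_square)
      also have "\<dots> = 1 / real n - 1 / real (Suc n)"
        using step assms by (simp add: field_simps)
      finally show ?thesis .
    qed
    ultimately show ?case
      using step.IH by simp
  qed simp
  thus ?thesis
    by (smt (verit) divide_nonneg_nonneg of_nat_0_le_iff)
qed simp

text \<open>Union bound: two rough numbers that are not coprime share a prime above
  \<open>P\<close>. Each \<open>p\<close> costs at most the square of \<open>r / p\<close>, and
  these costs are summed over all integers \<open>p > P\<close>, not only primes.\<close>

lemma sum_noncoprime_rough_le:
  fixes P z :: nat
  assumes "P > 0"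
  defines "R \<equiv> rough {p. prime p \<and> p \<le> P} z"
  shows "(\<Sum>a\<in>R. \<Sum>b\<in>R. of_bool (\<not> coprime a b) / (real a * real b)) \<le> (\<Sum>a\<in>R. 1 / real a) ^ 2 / real P"
proof -
  define r where "r = (\<Sum>a\<in>R. 1 / real a)"
  have ind: "of_bool (\<not> coprime a b) \<le> (\<Sum>p\<in>{P<..z}. of_bool (p dvd a) * of_bool (p dvd b) :: real)"
    if ab: "a \<in> R" "b \<in> R" for a b
  proof (cases "coprime a b")
    case False
    hence "gcd a b \<noteq> 1"
      by (simp add: coprime_iff_gcd_eq_1)
    then obtain p where p: "prime p" "p dvd a" "p dvd b"
      using prime_factor_nat[of "gcd a b"] by auto
    have "p > P"
      using p ab(1) by (auto simp: R_def rough_def not_le[symmetric])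
    moreover have "p \<le> z"
      using p(2) ab(1) by (auto simp: R_def rough_def dest!: dvd_imp_le)
    ultimately have "(\<Sum>p\<in>{p}. of_bool (p dvd a) * of_bool (p dvd b))
        \<le> (\<Sum>p\<in>{P<..z}. of_bool (p dvd a) * of_bool (p dvd b) :: real)"
      by (intro sum_mono2) auto
    thus ?thesis
      using p by simp
  qed (auto intro: sum_nonneg)
  have "(\<Sum>a\<in>R. \<Sum>b\<in>R. of_bool (\<not> coprime a b) / (real a * real b))
      \<le> (\<Sum>a\<in>R. \<Sum>b\<in>R. (\<Sum>p\<in>{P<..z}. of_bool (p dvd a) * of_bool (p dvd b)) / (real a * real b))"
    using ind by (intro sum_mono divide_right_mono) auto
  also have "\<dots> = (\<Sum>a\<in>R. \<Sum>b\<in>R. \<Sum>p\<in>{P<..z}. (of_bool (p dvd a) / real a) * (of_bool (p dvd b) / real b))"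
    by (simp only: sum_divide_distrib times_divide_times_eq)
  also have "\<dots> = (\<Sum>a\<in>R. \<Sum>p\<in>{P<..z}. \<Sum>b\<in>R. (of_bool (p dvd a) / real a) * (of_bool (p dvd b) / real b))"
    by (intro sum.cong refl sum.swap)
  also have "\<dots> = (\<Sum>p\<in>{P<..z}. \<Sum>a\<in>R. \<Sum>b\<in>R. (of_bool (p dvd a) / real a) * (of_bool (p dvd b) / real b))"
    by (rule sum.swap)
  also have "\<dots> = (\<Sum>p\<in>{P<..z}. (\<Sum>a\<in>R. of_bool (p dvd a) / real a) ^ 2)"
    by (simp only: sum_product power2_eq_square)
  also have "\<dots> \<le> (\<Sum>p\<in>{P<..z}. (r / real p) ^ 2)"
    unfolding R_def r_def
    by (intro sum_mono power_mono sum_rough_multiples_le sum_nonneg) auto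
  also have "\<dots> = r ^ 2 * (\<Sum>p\<in>{P<..z}. 1 / real p ^ 2)"
    by (simp add: power_divide sum_distrib_left)
  also have "\<dots> \<le> r ^ 2 * (1 / real P)"
    using assms(1) by (intro mult_left_mono sum_inverse_squares_le) auto
  finally show ?thesis
    by (simp add: r_def)
qed

definition coprime_triples :: "nat set \<Rightarrow> (nat \<times> nat \<times> nat) set" where
  "coprime_triples R = {(a, b, c). a \<in> R \<and> b \<in> R \<and> c \<in> R \<and> coprime a b \<and> coprime a c \<and> coprime b c}"

text \<open>All triples together contribute the cube of the sum over \<open>R\<close>; each of the
  three pairs of coordinates loses at most the fraction \<open>1 / P\<close> to common factors. For
  pairwise coprime entries the lcm is the product.\<close>

lemma sum_coprime_triples_ge:
  fixes P z :: nat
  assumes "P > 0"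
  defines "R \<equiv> rough {p. prime p \<and> p \<le> P} z"
  shows "(1 - 3 / real P) * (\<Sum>a\<in>R. 1 / real a) ^ 3 \<le> (\<Sum>t\<in>coprime_triples R. 1 / real (lcm3 t))"
proof -
  define r where "r = (\<Sum>a\<in>R. 1 / real a)"
  define u where "u = (\<lambda>a b::nat. of_bool (\<not> coprime a b) :: real)"
  define U where "U = (\<Sum>a\<in>R. \<Sum>b\<in>R. u a b / (real a * real b))"
  have r: "r \<ge> 0"
    by (auto simp: r_def intro: sum_nonneg)
  have fin: "finite R" by (simp add: R_def)
  have prod3: "(\<Sum>a\<in>R. \<Sum>b\<in>R. \<Sum>c\<in>R. 1 / (real a * real b * real c)) = r ^ 3"
    by (simp add: r_def power3_eq_cube sum_distrib_left sum_distrib_right sum_divide_distrib mult_ac)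
  have uab: "(\<Sum>a\<in>R. \<Sum>b\<in>R. \<Sum>c\<in>R. u a b / (real a * real b * real c)) = U * r"
    unfolding U_def r_def sum_distrib_right unfolding sum_distrib_left by simp
  have ubc: "(\<Sum>a\<in>R. \<Sum>b\<in>R. \<Sum>c\<in>R. u b c / (real a * real b * real c)) = r * U"
    unfolding U_def r_def sum_distrib_right unfolding sum_distrib_left by (simp add: mult_ac)
  have "(\<Sum>a\<in>R. \<Sum>b\<in>R. \<Sum>c\<in>R. u a c / (real a * real b * real c))
      = (\<Sum>a\<in>R. \<Sum>c\<in>R. \<Sum>b\<in>R. u a c / (real a * real b * real c))"
    by (intro sum.cong refl sum.swap)
  also have "\<dots> = U * r"
    unfolding U_def r_def sum_distrib_right unfolding sum_distrib_left by (simp add: mult_ac)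
  finally have uac: "(\<Sum>a\<in>R. \<Sum>b\<in>R. \<Sum>c\<in>R. u a c / (real a * real b * real c)) = U * r" .
  have "U \<le> r ^ 2 / real P"
    using sum_noncoprime_rough_le[OF assms(1), of z] by (simp add: U_def u_def r_def R_def)
  hence "U * r \<le> r ^ 2 / real P * r"
    using r by (intro mult_right_mono) auto
  hence "(1 - 3 / real P) * r ^ 3 \<le> r ^ 3 - U * r - U * r - r * U"
    using mult_left_mono[of "U * r" "r ^ 2 / real P * r" 3]
    by (simp add: power3_eq_cube power2_eq_square algebra_simps)
  also have "\<dots> = (\<Sum>a\<in>R. \<Sum>b\<in>R. \<Sum>c\<in>R. (1 - u a b - u a c - u b c) / (real a * real b * real c))"
    by (simp only: diff_divide_distrib sum_subtractf prod3 uab uac ubc)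
  also have "\<dots> \<le> (\<Sum>a\<in>R. \<Sum>b\<in>R. \<Sum>c\<in>R. of_bool (coprime a b \<and> coprime a c \<and> coprime b c) / (real a * real b * real c))"
    by (intro sum_mono divide_right_mono) (auto simp: u_def)
  also have "\<dots> = (\<Sum>(a, b, c)\<in>R \<times> R \<times> R. of_bool (coprime a b \<and> coprime a c \<and> coprime b c) / (real a * real b * real c))"
    by (simp add: sum.cartesian_product)
  also have "\<dots> = (\<Sum>t\<in>coprime_triples R. 1 / real (lcm3 t))"
    using fin
    by (intro sum.mono_neutral_cong_right)
       (auto simp: coprime_triples_def lcm3_def lcm_coprime coprime_mult_right_iff)
  finally show ?thesis
    by (simp add: r_def)
qed

subsection \<open>Adjoining small primes\<close>

text \<open>Once the smaller power of \<open>p\<close> is factored out, the leftover power of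
  \<open>p\<close> occurs on one side only and is coprime to the other.\<close>

lemma gcd_prime_powers_mult:
  fixes p a b :: nat
  assumes "prime p" "\<not> p dvd a" "\<not> p dvd b"
  shows "gcd (p ^ i * a) (p ^ j * b) = p ^ min i j * gcd a b"
proof -
  have *: "gcd (p ^ i * a) (p ^ j * b) = p ^ i * gcd a b" if "i \<le> j" "\<not> p dvd a" for i j a b
  proof -
    have "coprime a (p ^ (j - i))"
      using assms(1) that by (metis coprime_commute coprime_power_right_iff prime_imp_coprime_nat)
    hence "gcd a (p ^ (j - i) * b) = gcd a b"
      by (rule gcd_mult_right_left_cancel)
    moreover have "p ^ j * b = p ^ i * (p ^ (j - i) * b)"
      using that by (simp flip: power_add mult.assoc)
    ultimately show ?thesis
      by (metis gcd_mult_distrib_nat)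
  qed
  show ?thesis
    using *[of i j a b] *[of j i b a] assms by (cases "i \<le> j") (simp_all add: min_def gcd.commute)
qed

lemma lcm_prime_powers_mult:
  fixes p a b :: nat
  assumes "prime p" "\<not> p dvd a" "\<not> p dvd b"
  shows "lcm (p ^ i * a) (p ^ j * b) = p ^ max i j * lcm a b"
proof -
  have "p ^ min i j * gcd a b * lcm (p ^ i * a) (p ^ j * b) = p ^ i * a * (p ^ j * b)"
    using prod_gcd_lcm_nat[of "p ^ i * a" "p ^ j * b"] by (simp add: gcd_prime_powers_mult[OF assms])
  also have "\<dots> = p ^ (min i j + max i j) * (gcd a b * lcm a b)"
    using prod_gcd_lcm_nat[of a b] by (simp add: power_add min_def max_def)
  also have "\<dots> = p ^ min i j * gcd a b * (p ^ max i j * lcm a b)"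
    by (simp add: power_add)
  finally show ?thesis
    using assms by (auto simp: prime_gt_0_nat)
qed

text \<open>Exponents of \<open>p\<close> in a triple, truncated at \<open>E\<close>. With \<nu> and
  \<mu> the valuations of \<open>h\<close> and \<open>2 * h\<close>, the minimum conditions are the
  \<open>p\<close>-part of \<open>compatible\<close>.\<close>

definition local_exps :: "nat \<Rightarrow> nat \<Rightarrow> nat \<Rightarrow> (nat \<times> nat \<times> nat) set" where
  "local_exps \<nu> \<mu> E = {(i, j, k). i \<le> E \<and> j \<le> E \<and> k \<le> E \<and> min i j \<le> \<nu> \<and> min i k \<le> \<nu> \<and> min j k \<le> \<mu>}"

text \<open>At \<open>q = 1 / p\<close> the summand is the reciprocal of the \<open>p\<close>-part
  of \<open>lcm3\<close>.\<close>

definition local_sum :: "real \<Rightarrow> nat \<Rightarrow> nat \<Rightarrow> nat \<Rightarrow> real" where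
  "local_sum q \<nu> \<mu> E = (\<Sum>(i, j, k)\<in>local_exps \<nu> \<mu> E. q ^ max i (max j k))"

lemma finite_local_exps [simp]: "finite (local_exps \<nu> \<mu> E)"
  by (rule finite_subset[of _ "{..E} \<times> {..E} \<times> {..E}"]) (auto simp: local_exps_def)

definition admissible :: "nat set \<Rightarrow> nat \<Rightarrow> nat \<Rightarrow> (nat \<times> nat \<times> nat) set" where
  "admissible Q h z = {t. t \<in> rough Q z \<times> rough Q z \<times> rough Q z \<and> compatible h t}"

definition local_factor :: "nat \<Rightarrow> nat \<Rightarrow> nat \<Rightarrow> real" where
  "local_factor h E p = local_sum (1 / real p) (multiplicity p h) (multiplicity p (2 * h)) E"

text \<open>Multiplying the entries of a triple prime to \<open>p\<close> by admissible powers of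
  \<open>p\<close> is injective, preserves compatibility, and multiplies \<open>lcm3\<close> by the
  largest power. The sum over all results therefore factors, while the range of the entries grows by
  \<open>p ^ E\<close>.\<close>

lemma adjoin_prime:
  assumes "prime p" "p \<notin> Q" "\<forall>q\<in>Q. prime q" "h > 0"
    and F: "F \<subseteq> admissible (insert p Q) h z"
  shows "\<exists>T \<subseteq> admissible Q h (z * p ^ E).
           (\<Sum>t\<in>T. 1 / lcm3 t) = local_factor h E p * (\<Sum>t\<in>F. 1 / lcm3 t)"
proof -
  define X where "X = local_exps (multiplicity p h) (multiplicity p (2 * h)) E"
  define \<phi> where "\<phi> = (\<lambda>((i, j, k), (a, b, c)). (p ^ i * a, p ^ j * b, p ^ k * c))"
  have pow_dvd: "p ^ m dvd n \<longleftrightarrow> m \<le> multiplicity p n" if "n > 0" for m n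
    using assms(1) that by (intro power_dvd_iff_le_multiplicity) auto
  have rough: "p ^ i * a \<in> rough Q (z * p ^ E)" if "a \<in> rough (insert p Q) z" "i \<le> E" for a i
  proof -
    have "p ^ i * a \<le> p ^ E * z"
      using that assms(1) by (intro mult_le_mono power_increasing prime_ge_1_nat) (auto simp: rough_def)
    moreover have "\<not> q dvd p ^ i * a" if "q \<in> Q" for q
    proof
      assume "q dvd p ^ i * a"
      moreover have "\<not> q dvd a"
        using \<open>a \<in> _\<close> \<open>q \<in> Q\<close> by (simp add: rough_def)
      ultimately have "q dvd p ^ i"
        using assms(3) that by (auto simp: prime_dvd_mult_iff)
      hence "q dvd p"
        using assms(3) that prime_dvd_power by blast
      thus False
        using assms(1-3) that primes_dvd_imp_eq by blast
    qed
    moreover have "p ^ i * a > 0"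
      using that assms(1) by (auto simp: rough_def prime_gt_0_nat)
    ultimately show ?thesis
      by (auto simp: rough_def mult.commute)
  qed
  have npd: "\<not> p dvd a" "a > 0" if "a \<in> rough (insert p Q) z" for a
    using that by (auto simp: rough_def)
  \<comment> \<open>The \<open>p\<close>-part of the gcd and the part prime to \<open>p\<close> are
    coprime, so they may be checked separately.\<close>
  have gcd_dvd: "gcd (p ^ i * a) (p ^ j * b) dvd n"
    if "a \<in> rough (insert p Q) z" "b \<in> rough (insert p Q) z" "gcd a b dvd n" "min i j \<le> multiplicity p n" "n > 0"
    for i j a b n
  proof -
    have "p ^ min i j dvd n"
      using that by (simp add: pow_dvd)
    moreover have "coprime (p ^ min i j) (gcd a b)"
      using npd[OF that(1)] assms(1)
      by (metis coprime_power_left_iff gcd_dvd1 dvd_trans prime_imp_coprime_nat)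
    ultimately show ?thesis
      using that npd assms(1) by (simp add: gcd_prime_powers_mult divides_mult)
  qed
  have image: "\<phi> ` (X \<times> F) \<subseteq> admissible Q h (z * p ^ E)"
  proof (rule image_subsetI)
    fix w assume w: "w \<in> X \<times> F"
    obtain i j k a b c where ijk: "w = ((i, j, k), (a, b, c))"
      by (metis prod.exhaust)
    have e: "i \<le> E" "j \<le> E" "k \<le> E" "min i j \<le> multiplicity p h" "min i k \<le> multiplicity p h"
        "min j k \<le> multiplicity p (2 * h)"
      using w by (auto simp: ijk X_def local_exps_def)
    have abc: "a \<in> rough (insert p Q) z" "b \<in> rough (insert p Q) z" "c \<in> rough (insert p Q) z"
        "gcd a b dvd h" "gcd a c dvd h" "gcd b c dvd 2 * h"
      using w F by (auto simp: ijk admissible_def compatible_def)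
    have "compatible h (p ^ i * a, p ^ j * b, p ^ k * c)"
      using gcd_dvd[OF abc(1,2,4) e(4)] gcd_dvd[OF abc(1,3,5) e(5)] gcd_dvd[OF abc(2,3,6) e(6)] \<open>h > 0\<close>
      by (simp add: compatible_def)
    thus "\<phi> w \<in> admissible Q h (z * p ^ E)"
      using rough[OF abc(1) e(1)] rough[OF abc(2) e(2)] rough[OF abc(3) e(3)]
      by (simp add: ijk \<phi>_def admissible_def)
  qed
  have lcm3: "1 / real (lcm3 (\<phi> (e, t))) = (case e of (i, j, k) \<Rightarrow> (1 / real p) ^ max i (max j k)) * (1 / lcm3 t)"
    if "t \<in> F" for e t
  proof -
    obtain i j k a b c where et: "e = (i, j, k)" "t = (a, b, c)"
      by (cases e, cases t)
    have abc: "\<not> p dvd a" "\<not> p dvd b" "\<not> p dvd c"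
      using that F npd unfolding et admissible_def by auto
    have "lcm b c dvd b * c"
      by simp
    hence "\<not> p dvd lcm b c"
      using abc assms(1) by (metis dvd_trans prime_dvd_mult_iff)
    thus ?thesis
      using abc assms(1) by (simp add: et \<phi>_def lcm3_def lcm_prime_powers_mult power_one_over)
  qed
  have inj: "inj_on \<phi> (X \<times> F)"
  proof -
    \<comment> \<open>The valuation at \<open>p\<close> recovers the exponent, and cancellation then
      recovers the cofactor.\<close>
    have eq: "i = j \<and> a = b"
      if "p ^ i * a = p ^ j * b" "a \<in> rough (insert p Q) z" "b \<in> rough (insert p Q) z" for i j a b
    proof -
      have "multiplicity p (p ^ i * a) = i" "multiplicity p (p ^ j * b) = j"
        using npd[OF that(2)] npd[OF that(3)] assms(1)
        by (auto simp: prime_elem_multiplicity_mult_distrib not_dvd_imp_multiplicity_0)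
      thus ?thesis
        using that assms(1) by auto
    qed
    show ?thesis
    proof (rule inj_onI)
      fix v w assume vw: "v \<in> X \<times> F" "w \<in> X \<times> F" "\<phi> v = \<phi> w"
      obtain i j k a b c i' j' k' a' b' c'
        where ijk: "v = ((i, j, k), (a, b, c))" "w = ((i', j', k'), (a', b', c'))"
        by (metis prod.exhaust)
      have "(a, b, c) \<in> F" "(a', b', c') \<in> F"
        using vw by (auto simp: ijk)
      hence "a \<in> rough (insert p Q) z" "b \<in> rough (insert p Q) z" "c \<in> rough (insert p Q) z"
        "a' \<in> rough (insert p Q) z" "b' \<in> rough (insert p Q) z" "c' \<in> rough (insert p Q) z"
        using F by (auto simp: admissible_def)
      thus "v = w"
        using vw(3) eq[of i a i' a'] eq[of j b j' b'] eq[of k c k' c'] by (simp add: ijk \<phi>_def)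
    qed
  qed
  have "(\<Sum>t\<in>\<phi> ` (X \<times> F). 1 / real (lcm3 t)) = (\<Sum>(e, t)\<in>X \<times> F. 1 / real (lcm3 (\<phi> (e, t))))"
    by (subst sum.reindex[OF inj]) (simp add: case_prod_unfold)
  also have "\<dots> = (\<Sum>(e, t)\<in>X \<times> F. (case e of (i, j, k) \<Rightarrow> (1 / real p) ^ max i (max j k)) * (1 / lcm3 t))"
    by (intro sum.cong) (auto simp: lcm3)
  also have "\<dots> = local_factor h E p * (\<Sum>t\<in>F. 1 / lcm3 t)"
    unfolding local_factor_def local_sum_def sum_product sum.cartesian_product X_def[symmetric] ..
  finally show ?thesis
    using image by blast
qed

lemma adjoin_primes:
  assumes "finite Q" "\<forall>q\<in>Q. prime q" "h > 0" "F \<subseteq> admissible Q h z"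
  shows "\<exists>T \<subseteq> admissible {} h (z * (\<Prod>p\<in>Q. p ^ E)).
           (\<Sum>t\<in>T. 1 / lcm3 t) = (\<Prod>p\<in>Q. local_factor h E p) * (\<Sum>t\<in>F. 1 / lcm3 t)"
  using assms
proof (induction Q arbitrary: z F rule: finite_induct)
  case empty
  thus ?case by auto
next
  case (insert p Q)
  obtain F' where F': "F' \<subseteq> admissible Q h (z * p ^ E)"
      "(\<Sum>t\<in>F'. 1 / lcm3 t) = local_factor h E p * (\<Sum>t\<in>F. 1 / lcm3 t)"
    using adjoin_prime[of p Q h F z E] insert.prems insert.hyps by auto
  obtain T where T: "T \<subseteq> admissible {} h (z * p ^ E * (\<Prod>p\<in>Q. p ^ E))"
      "(\<Sum>t\<in>T. 1 / lcm3 t) = (\<Prod>p\<in>Q. local_factor h E p) * (\<Sum>t\<in>F'. 1 / lcm3 t)"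
    using insert.IH[OF _ _ F'(1)] insert.prems by auto
  show ?case
    using T insert.hyps by (intro exI[of _ T]) (simp add: F'(2) mult_ac)
qed

subsection \<open>Local factors\<close>

text \<open>The triples of \<open>local_exps\<close> whose largest exponent is exactly
  \<open>m\<close>, that is, the increment of the truncated local sum.\<close>

definition local_layer :: "nat \<Rightarrow> nat \<Rightarrow> nat \<Rightarrow> (nat \<times> nat \<times> nat) set" where
  "local_layer \<nu> \<mu> m = {(i, j, k). i \<le> m \<and> j \<le> m \<and> k \<le> m \<and> (i = m \<or> j = m \<or> k = m) \<and>
     (i \<le> \<nu> \<or> j \<le> \<nu>) \<and> (i \<le> \<nu> \<or> k \<le> \<nu>) \<and> (j \<le> \<mu> \<or> k \<le> \<mu>)}"

lemma local_sum_0: "local_sum q \<nu> \<mu> 0 = 1"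
proof -
  have "local_exps \<nu> \<mu> 0 = {(0, 0, 0)}"
    by (auto simp: local_exps_def)
  thus ?thesis
    by (simp add: local_sum_def)
qed

lemma local_sum_Suc:
  "local_sum q \<nu> \<mu> (Suc E) = local_sum q \<nu> \<mu> E + real (card (local_layer \<nu> \<mu> (Suc E))) * q ^ Suc E"
proof -
  have split: "local_exps \<nu> \<mu> (Suc E) = local_exps \<nu> \<mu> E \<union> local_layer \<nu> \<mu> (Suc E)"
    by (auto simp: local_exps_def local_layer_def min_le_iff_disj)
  have disj: "local_exps \<nu> \<mu> E \<inter> local_layer \<nu> \<mu> (Suc E) = {}"
    by (auto simp: local_exps_def local_layer_def)
  have fin: "finite (local_layer \<nu> \<mu> (Suc E))"
    using split by (metis finite_Un finite_local_exps)
  have "(\<Sum>(i, j, k)\<in>local_layer \<nu> \<mu> (Suc E). q ^ max i (max j k)) = (\<Sum>t\<in>local_layer \<nu> \<mu> (Suc E). q ^ Suc E)"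
    by (intro sum.cong refl) (auto simp: local_layer_def max_def)
  thus ?thesis
    using fin disj by (simp add: local_sum_def split sum.union_disjoint)
qed

lemma local_sum_ge_1:
  assumes "q \<ge> 0"
  shows "local_sum q \<nu> \<mu> E \<ge> 1"
  by (induction E) (use assms in \<open>auto simp: local_sum_0 local_sum_Suc intro: add_increasing2\<close>)

text \<open>As long as no exponent exceeds \<nu> the minimum conditions are void, so the layer is a
  difference of two cubes.\<close>

lemma card_local_layer_low:
  assumes "Suc m \<le> \<nu>" "\<nu> \<le> \<mu>"
  shows "real (card (local_layer \<nu> \<mu> (Suc m))) = (real m + 2) ^ 3 - (real m + 1) ^ 3"
proof -
  define A B where "A = {..Suc m} \<times> {..Suc m} \<times> {..Suc m}" and "B = {..m} \<times> {..m} \<times> {..m}"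
  have "local_layer \<nu> \<mu> (Suc m) = A - B"
    using assms by (auto simp: local_layer_def A_def B_def)
  moreover have "card (A - B) = card A - card B"
    by (intro card_Diff_subset) (auto simp: A_def B_def)
  moreover have "card B \<le> card A"
    by (intro card_mono) (auto simp: A_def B_def)
  moreover have "real (card A) = (real m + 2) ^ 3" "real (card B) = (real m + 1) ^ 3"
    by (simp_all add: A_def B_def card_cartesian_product power3_eq_cube algebra_simps)
  ultimately show ?thesis
    by simp
qed

text \<open>Above the valuation of \<open>h\<close>, exactly one exponent is large, except that at \<open>p = 2\<close> also the
  exponents of \<open>n - h\<close> and \<open>n + h\<close> may both be large as long as one of them is \<open>\<nu> + 1\<close>.\<close>

definition axes :: "nat \<Rightarrow> nat \<Rightarrow> (nat \<times> nat \<times> nat) set" where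
  "axes \<nu> m = {m} \<times> {..\<nu>} \<times> {..\<nu>} \<union> ({..\<nu>} \<times> {m} \<times> {..\<nu>} \<union> {..\<nu>} \<times> {..\<nu>} \<times> {m})"

lemma card_axes:
  assumes "m > \<nu>"
  shows "card (axes \<nu> m) = 3 * (\<nu> + 1) ^ 2"
  using assms unfolding axes_def
  by (subst card_Un_disjoint; (subst card_Un_disjoint)?)
     (auto simp: card_cartesian_product power2_eq_square)

lemma card_local_layer_high:
  assumes "m > \<nu>"
  shows "card (local_layer \<nu> \<nu> m) = 3 * (\<nu> + 1) ^ 2"
proof -
  have "local_layer \<nu> \<nu> m = axes \<nu> m"
    using assms by (auto simp: local_layer_def axes_def)
  thus ?thesis
    using card_axes[OF assms] by simp
qed

text \<open>At this level the two families with both \<open>j\<close> and \<open>k\<close> large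
  coincide, giving \<open>\<nu> + 1\<close> extra triples; at higher levels they are disjoint and
  the extra count doubles.\<close>

lemma card_local_layer_even_first:
  "card (local_layer \<nu> (Suc \<nu>) (Suc \<nu>)) = 3 * (\<nu> + 1) ^ 2 + (\<nu> + 1)"
proof -
  have "local_layer \<nu> (Suc \<nu>) (Suc \<nu>) = axes \<nu> (Suc \<nu>) \<union> {..\<nu>} \<times> {Suc \<nu>} \<times> {Suc \<nu>}"
    by (auto simp: local_layer_def axes_def)
  also have "card \<dots> = card (axes \<nu> (Suc \<nu>)) + card ({..\<nu>} \<times> {Suc \<nu>} \<times> {Suc \<nu>})"
    by (intro card_Un_disjoint) (auto simp: axes_def)
  finally show ?thesis
    by (simp add: card_axes card_cartesian_product)
qed

lemma card_local_layer_even_high: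
  assumes "m > Suc \<nu>"
  shows "card (local_layer \<nu> (Suc \<nu>) m) = 3 * (\<nu> + 1) ^ 2 + 2 * (\<nu> + 1)"
proof -
  have "local_layer \<nu> (Suc \<nu>) m = axes \<nu> m \<union> ({..\<nu>} \<times> {m} \<times> {Suc \<nu>} \<union> {..\<nu>} \<times> {Suc \<nu>} \<times> {m})"
    using assms by (auto simp: local_layer_def axes_def)
  also have "card \<dots> = card (axes \<nu> m) + card ({..\<nu>} \<times> {m} \<times> {Suc \<nu>} \<union> {..\<nu>} \<times> {Suc \<nu>} \<times> {m})"
    using assms by (intro card_Un_disjoint) (auto simp: axes_def)
  also have "card ({..\<nu>} \<times> {m} \<times> {Suc \<nu>} \<union> {..\<nu>} \<times> {Suc \<nu>} \<times> {m})
      = card ({..\<nu>} \<times> {m} \<times> {Suc \<nu>}) + card ({..\<nu>} \<times> {Suc \<nu>} \<times> {m})"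
    using assms by (intro card_Un_disjoint) auto
  finally show ?thesis
    using assms by (simp add: card_axes card_cartesian_product)
qed

text \<open>At \<open>q = 1 / p\<close> this is the numerator in \<open>f_pp\<close> for
  \<open>p > 2\<close>; for \<open>\<mu> = \<nu>\<close> it is the limit of
  \<open>(1 - q) ^ 3 * local_sum q \<nu> \<nu> E\<close>.\<close>

definition local_limit :: "real \<Rightarrow> nat \<Rightarrow> real" where
  "local_limit q \<nu> = 1 + 4 * q + q ^ 2 - (3 * real \<nu> + 4) * q ^ (\<nu> + 1) - 4 * q ^ (\<nu> + 2) + (3 * real \<nu> + 2) * q ^ (\<nu> + 3)"

text \<open>A truncation at \<open>E \<le> \<nu>\<close> looks as if the valuation were
  \<open>E\<close>. The subtracted term is the geometric tail of layers of constant size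
  \<open>3 * (E + 1) ^ 2\<close>, scaled by \<open>(1 - q) ^ 3\<close>.\<close>

lemma local_sum_low:
  assumes "E \<le> \<nu>" "\<nu> \<le> \<mu>"
  shows "(1 - q) ^ 3 * local_sum q \<nu> \<mu> E = local_limit q E - 3 * (real E + 1) ^ 2 * q ^ (E + 1) * (1 - q) ^ 2"
  using assms(1)
proof (induction E)
  case 0
  show ?case
    by (simp add: local_sum_0 local_limit_def power2_eq_square power3_eq_cube algebra_simps)
next
  case (Suc E)
  have "(1 - q) ^ 3 * local_sum q \<nu> \<mu> (Suc E)
      = local_limit q E - 3 * (real E + 1) ^ 2 * q ^ (E + 1) * (1 - q) ^ 2
        + (1 - q) ^ 3 * ((real E + 2) ^ 3 - (real E + 1) ^ 3) * q ^ Suc E"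
    using Suc card_local_layer_low[OF Suc.prems assms(2)] by (simp add: local_sum_Suc distrib_left)
  also have "\<dots> = local_limit q (Suc E) - 3 * (real (Suc E) + 1) ^ 2 * q ^ (Suc E + 1) * (1 - q) ^ 2"
  proof -
    \<comment> \<open>Writing all powers through \<open>v\<close> leaves a polynomial identity in
      \<open>q\<close>, \<open>v\<close> and \<open>E\<close>.\<close>
    define v where "v = q ^ E"
    have "q ^ (E + 1) = v * q" "q ^ (E + 2) = v * q ^ 2" "q ^ (E + 3) = v * q ^ 3" "q ^ Suc E = v * q"
        "q ^ (Suc E + 1) = v * q ^ 2" "q ^ (Suc E + 2) = v * q ^ 3" "q ^ (Suc E + 3) = v * (q * q ^ 3)"
      by (simp_all add: v_def power_add power2_eq_square power3_eq_cube power4_eq_xxxx)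
    thus ?thesis
      by (simp only: local_limit_def of_nat_Suc) (simp add: power2_eq_square power3_eq_cube algebra_simps)
  qed
  finally show ?case .
qed

text \<open>Beyond \<nu> all layers have the same size, so each step only shortens the geometric
  tail.\<close>

lemma local_sum_odd:
  "(1 - q) ^ 3 * local_sum q \<nu> \<nu> (\<nu> + t) = local_limit q \<nu> - 3 * (real \<nu> + 1) ^ 2 * q ^ (\<nu> + 1 + t) * (1 - q) ^ 2"
proof (induction t)
  case 0
  show ?case
    using local_sum_low[of \<nu> \<nu> \<nu> q] by simp
next
  case (Suc t)
  have "(1 - q) ^ 3 * local_sum q \<nu> \<nu> (\<nu> + Suc t)
      = (1 - q) ^ 3 * local_sum q \<nu> \<nu> (\<nu> + t) + (1 - q) ^ 3 * (3 * (real \<nu> + 1) ^ 2) * q ^ (\<nu> + 1 + t)"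
    using card_local_layer_high[of \<nu> "Suc (\<nu> + t)"] by (simp add: local_sum_Suc algebra_simps)
  also have "\<dots> = local_limit q \<nu> - 3 * (real \<nu> + 1) ^ 2 * q ^ (\<nu> + 1 + Suc t) * (1 - q) ^ 2"
  proof -
    define v where "v = q ^ (\<nu> + 1 + t)"
    have "q ^ (\<nu> + 1 + Suc t) = v * q"
      by (simp add: v_def)
    thus ?thesis
      by (simp only: Suc.IH flip: v_def) (simp add: power2_eq_square power3_eq_cube algebra_simps)
  qed
  finally show ?case .
qed

text \<open>The formula starts at \<open>\<nu> + 1\<close>, since that layer is exceptional and the
  later ones have constant size. The last term is their remaining tail at
  \<open>q = 1/2\<close>.\<close>

lemma local_sum_even:
  "local_sum (1/2) \<nu> (Suc \<nu>) (Suc \<nu> + t)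
     = 26 - (41 + 15 * real \<nu>) / 2 ^ (\<nu> + 1) - (3 * (real \<nu> + 1) ^ 2 + 2 * (real \<nu> + 1)) / 2 ^ (Suc \<nu> + t)"
proof (induction t)
  case 0
  have "local_sum (1/2) \<nu> (Suc \<nu>) \<nu> = 8 * (local_limit (1/2) \<nu> - 3 * (real \<nu> + 1) ^ 2 * (1/2) ^ (\<nu> + 1) / 4)"
    using local_sum_low[of \<nu> \<nu> "Suc \<nu>" "1/2"] by (simp add: power2_eq_square power3_eq_cube)
  moreover have "real (card (local_layer \<nu> (Suc \<nu>) (Suc \<nu>))) = 3 * (real \<nu> + 1) ^ 2 + (real \<nu> + 1)"
    by (simp add: card_local_layer_even_first)
  ultimately have "local_sum (1/2) \<nu> (Suc \<nu>) (Suc \<nu>)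
      = 8 * (local_limit (1/2) \<nu> - 3 * (real \<nu> + 1) ^ 2 * (1/2) ^ (\<nu> + 1) / 4)
        + (3 * (real \<nu> + 1) ^ 2 + (real \<nu> + 1)) * (1/2) ^ Suc \<nu>"
    by (simp only: local_sum_Suc)
  moreover define v :: real where "v = (1/2) ^ \<nu>"
  have "(1/2) ^ (\<nu> + 1) = v / 2" "(1/2) ^ (\<nu> + 2) = v / 4" "(1/2) ^ (\<nu> + 3) = v / 8" "(1/2) ^ Suc \<nu> = v / 2"
    by (simp_all add: v_def power_add power3_eq_cube)
  moreover have "x / 2 ^ (\<nu> + 1) = x * (v / 2)" "x / 2 ^ (Suc \<nu> + 0) = x * (v / 2)" for x :: real
    by (simp_all add: v_def power_one_over)
  ultimately show ?case
    by (simp only: local_limit_def add_0_right) (simp add: power2_eq_square algebra_simps)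
next
  case (Suc t)
  have "real (card (local_layer \<nu> (Suc \<nu>) (Suc (Suc \<nu> + t)))) = 3 * (real \<nu> + 1) ^ 2 + 2 * (real \<nu> + 1)"
    by (subst card_local_layer_even_high) auto
  hence "local_sum (1/2) \<nu> (Suc \<nu>) (Suc \<nu> + Suc t) = local_sum (1/2) \<nu> (Suc \<nu>) (Suc \<nu> + t)
      + (3 * (real \<nu> + 1) ^ 2 + 2 * (real \<nu> + 1)) * (1/2) ^ Suc (Suc \<nu> + t)"
    by (simp only: local_sum_Suc add_Suc_right)
  also have "\<dots> = 26 - (41 + 15 * real \<nu>) / 2 ^ (\<nu> + 1) - (3 * (real \<nu> + 1) ^ 2 + 2 * (real \<nu> + 1)) / 2 ^ (Suc \<nu> + Suc t)"
    unfolding Suc.IH by (simp add: power_one_over field_simps)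
  finally show ?case .
qed

section \<open>Limits of the local factors and comparison with the Euler product\<close>

definition euler_factor :: "nat \<Rightarrow> real" where
  "euler_factor p = (1 - 1 / real p) ^ 2 * (1 + 2 / real p)"

text \<open>Each of the three rough entries costs a factor \<open>1 - 1 / p\<close> for every small
  prime \<open>p\<close>; the cube charges this to the local sum.\<close>

definition normalized_factor :: "nat \<Rightarrow> nat \<Rightarrow> nat \<Rightarrow> real" where
  "normalized_factor h E p = (1 - 1 / real p) ^ 3 * local_factor h E p"

text \<open>The tails in the closed forms vanish as \<open>E\<close> grows. The constant 11/8 of
  \<open>c_h\<close> belongs to the prime 2, where the valuation of \<open>2 * h\<close> exceeds
  that of \<open>h\<close>.\<close>

lemma normalized_factor_tendsto:
  assumes "prime p" "h > 0"
  shows "(\<lambda>E. normalized_factor h E p)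
           \<longlonglongrightarrow> (if p = 2 then 11 / 8 else 1) * f_pp p (multiplicity p h) * euler_factor p"
proof (cases "p = 2")
  case False
  define q \<nu> where "q = 1 / real p" and "\<nu> = multiplicity p h"
  have p: "real p > 1"
    using prime_gt_1_nat[OF assms(1)] by simp
  have "multiplicity p 2 = 0"
    using False assms(1) by (metis not_dvd_imp_multiplicity_0 primes_dvd_imp_eq two_is_prime_nat)
  hence \<mu>: "multiplicity p (2 * h) = \<nu>"
    using assms by (simp add: \<nu>_def prime_elem_multiplicity_mult_distrib)
  have "(\<lambda>t. local_limit q \<nu> - 3 * (real \<nu> + 1) ^ 2 * q ^ (\<nu> + 1 + t) * (1 - q) ^ 2) \<longlonglongrightarrow>
      local_limit q \<nu> - 3 * (real \<nu> + 1) ^ 2 * (q ^ (\<nu> + 1) * 0) * (1 - q) ^ 2"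
    unfolding power_add[of q "\<nu> + 1"] using p
    by (intro tendsto_intros LIMSEQ_power_zero) (auto simp: q_def)
  hence "(\<lambda>t. normalized_factor h (t + \<nu>) p) \<longlonglongrightarrow> local_limit q \<nu>"
    by (simp add: normalized_factor_def local_factor_def \<mu> flip: \<nu>_def q_def)
       (simp add: local_sum_odd add.commute[of _ \<nu>])
  hence "(\<lambda>t. normalized_factor h t p) \<longlonglongrightarrow> local_limit q \<nu>"
    by (rule LIMSEQ_offset)
  moreover have "local_limit q \<nu> = f_pp p \<nu> * euler_factor p"
  proof -
    have nz: "(1 + 2 / real p) \<noteq> 0" "(1 - 1 / real p) ^ 2 \<noteq> 0"
      using p by (auto simp: add_nonneg_eq_0_iff)
    have "local_limit q \<nu> = 1 + 4/real p + 1/real p^2 - (3*real \<nu> + 4)/real p^(\<nu>+1)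
             - 4/real p^(\<nu>+2) + (3*real \<nu> + 2)/real p^(\<nu>+3)"
      by (simp add: local_limit_def q_def power_one_over)
    thus ?thesis
      using nz False by (simp add: f_pp_def euler_factor_def)
  qed
  ultimately show ?thesis
    using False by (simp add: \<nu>_def)
next
  case True
  define \<nu> where "\<nu> = multiplicity p h"
  have \<mu>: "multiplicity 2 (2 * h) = Suc \<nu>"
    using assms by (simp add: \<nu>_def True prime_elem_multiplicity_mult_distrib)
  have "(\<lambda>t. 26 - (41 + 15 * real \<nu>) / 2 ^ (\<nu> + 1)
        - (3 * (real \<nu> + 1) ^ 2 + 2 * (real \<nu> + 1)) / 2 ^ Suc \<nu> * (1 / 2) ^ t)
      \<longlonglongrightarrow> 26 - (41 + 15 * real \<nu>) / 2 ^ (\<nu> + 1) - (3 * (real \<nu> + 1) ^ 2 + 2 * (real \<nu> + 1)) / 2 ^ Suc \<nu> * 0"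
    by (intro tendsto_intros LIMSEQ_power_zero) auto
  hence "(\<lambda>t. local_sum (1/2) \<nu> (Suc \<nu>) (Suc \<nu> + t)) \<longlonglongrightarrow> 26 - (41 + 15 * real \<nu>) / 2 ^ (\<nu> + 1)"
    unfolding local_sum_even by (simp add: power_one_over power_add mult.assoc)
  hence "(\<lambda>t. local_sum (1/2) \<nu> (Suc \<nu>) (t + Suc \<nu>)) \<longlonglongrightarrow> 26 - (41 + 15 * real \<nu>) / 2 ^ (\<nu> + 1)"
    by (simp only: add.commute)
  hence "(\<lambda>t. local_sum (1/2) \<nu> (Suc \<nu>) t) \<longlonglongrightarrow> 26 - (41 + 15 * real \<nu>) / 2 ^ (\<nu> + 1)"
    by (rule LIMSEQ_offset)
  hence "(\<lambda>t. 1/8 * local_sum (1/2) \<nu> (Suc \<nu>) t) \<longlonglongrightarrow> 1/8 * (26 - (41 + 15 * real \<nu>) / 2 ^ (\<nu> + 1))"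
    by (intro tendsto_intros)
  moreover have "normalized_factor h t p = 1/8 * local_sum (1/2) \<nu> (Suc \<nu>) t" for t
    using \<mu> by (simp add: normalized_factor_def local_factor_def True \<nu>_def power3_eq_cube)
  moreover have "1/8 * (26 - (41 + 15 * real \<nu>) / 2 ^ (\<nu> + 1)) = 11 / 8 * f_pp p \<nu> * euler_factor p"
    by (simp add: f_pp_def euler_factor_def True field_simps power2_eq_square)
  ultimately show ?thesis
    unfolding True \<nu>_def by (simp only: refl if_True)
qed

lemma normalized_factor_ge:
  assumes "prime p"
  shows "normalized_factor h E p \<ge> (1 - 1 / real p) ^ 3"
proof -
  have "(1 - 1 / real p) ^ 3 \<ge> 0"
    using prime_gt_1_nat[OF assms] by simp
  from mult_left_mono[OF local_sum_ge_1 this] show ?thesis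
    unfolding normalized_factor_def local_factor_def by simp
qed

lemma euler_factor_pos: "prime p \<Longrightarrow> euler_factor p > 0"
  using prime_gt_1_nat[of p] by (auto simp: euler_factor_def intro!: mult_pos_pos add_pos_nonneg)

text \<open>Positivity comes from the limit instead of the formula: the exponent triple of zeros
  keeps every normalized factor at least \<open>(1 - 1 / p) ^ 3\<close>.\<close>

lemma f_pp_pos:
  assumes "prime p" "h > 0"
  shows "f_pp p (multiplicity p h) > 0"
proof -
  have "(1 - 1 / real p) ^ 3 > 0"
    using prime_gt_1_nat[OF assms(1)] by simp
  also have "(1 - 1 / real p) ^ 3 \<le> (if p = 2 then 11 / 8 else 1) * f_pp p (multiplicity p h) * euler_factor p"
    by (rule LIMSEQ_le_const[OF normalized_factor_tendsto[OF assms]])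
       (use normalized_factor_ge[OF assms(1)] in blast)
  finally show ?thesis
    using euler_factor_pos[OF assms(1)] by (auto simp: zero_less_mult_iff split: if_splits)
qed

text \<open>This value lets the product defining \<open>f_mult\<close> run over all primes up to
  \<open>P\<close>.\<close>

lemma f_pp_0: "p > 1 \<Longrightarrow> f_pp p 0 = 1"
proof -
  assume "p > 1"
  hence "real p > 1" by simp
  have "1 + 4/real p + 1/real p^2 - 4/real p - 4/real p^2 + 2/real p^3 = (1 + 2/real p) * (1 - 1/real p)^2"
    by (simp add: power2_eq_square power3_eq_cube algebra_simps)
  thus ?thesis
    using \<open>real p > 1\<close> by (auto simp: f_pp_def add_nonneg_eq_0_iff power2_eq_square)
qed

lemma f_mult_eq:
  assumes "h > 0" "h \<le> P"
  shows "f_mult h = (\<Prod>p | prime p \<and> p \<le> P. f_pp p (multiplicity p h))"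
  unfolding f_mult_def
proof (rule prod.mono_neutral_left)
  show "prime_factors h \<subseteq> {p. prime p \<and> p \<le> P}"
    using assms by (auto simp: in_prime_factors_iff dest!: dvd_imp_le)
  show "\<forall>p\<in>{p. prime p \<and> p \<le> P} - prime_factors h. f_pp p (multiplicity p h) = 1"
    using assms by (auto simp: in_prime_factors_iff not_dvd_imp_multiplicity_0 intro!: f_pp_0 prime_gt_1_nat)
qed simp

text \<open>This form shows both that the factor is at most 1 and that it differs from 1 by at most
  \<open>3 / p ^ 2\<close>.\<close>

lemma euler_factor_eq: "p > 0 \<Longrightarrow> euler_factor p = 1 - (3 / real p ^ 2 - 2 / real p ^ 3)"
  by (simp add: euler_factor_def power2_eq_square power3_eq_cube field_simps)

lemma euler_factor_le_1: "prime p \<Longrightarrow> euler_factor p \<le> 1"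
  using prime_gt_1_nat[of p] by (simp add: euler_factor_eq power2_eq_square power3_eq_cube field_simps)

text \<open>The partial products decrease because all factors are at most 1, so their limit lies
  below each of them.\<close>

lemma euler_const_le: "euler_const \<le> (\<Prod>p | prime p \<and> p \<le> P. euler_factor p)"
proof -
  define e where "e = (\<lambda>p. if prime p then euler_factor p else 1)"
  have e: "0 < e p" "e p \<le> 1" for p
    by (auto simp: e_def euler_factor_pos euler_factor_le_1)
  have bound: "norm (e p - 1) \<le> 3 * (1 / real p ^ 2)" for p
  proof (cases "prime p")
    case True
    hence "norm (e p - 1) = 1 - e p"
      using e[of p] by simp
    also have "\<dots> = 3 / real p ^ 2 - 2 / real p ^ 3"
      using True by (simp add: e_def euler_factor_eq prime_gt_0_nat)
    finally show ?thesis by simp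
  qed (simp add: e_def)
  have "summable (\<lambda>p. 3 * (1 / real p ^ 2))"
    using inverse_power_summable[of 2, where 'a = real]
    by (intro summable_mult) (simp add: inverse_eq_divide)
  hence "summable (\<lambda>p. norm (e p - 1))"
    by (rule summable_comparison_test') (use bound in simp)
  \<comment> \<open>Convergence is what identifies \<open>prodinf e\<close> with the limit of the
    partial products.\<close>
  hence "convergent_prod e"
    by (intro abs_convergent_prod_imp_convergent_prod summable_imp_abs_convergent_prod)
  hence lim: "(\<lambda>n. \<Prod>i\<le>n. e i) \<longlonglongrightarrow> prodinf e"
    by (rule convergent_prod_LIMSEQ)
  have "decseq (\<lambda>n. \<Prod>i\<le>n. e i)"
  proof (rule decseq_SucI)
    fix n
    have "(\<Prod>i\<le>n. e i) * e (Suc n) \<le> (\<Prod>i\<le>n. e i)"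
      using e by (intro mult_left_le prod_nonneg) (auto intro: less_imp_le)
    thus "(\<Prod>i\<le>Suc n. e i) \<le> (\<Prod>i\<le>n. e i)"
      by simp
  qed
  hence "prodinf e \<le> (\<Prod>i\<le>P. e i)"
    using lim by (rule decseq_ge)
  also have "\<dots> = (\<Prod>p | prime p \<and> p \<le> P. euler_factor p)"
    by (intro prod.mono_neutral_cong_right) (auto simp: e_def)
  also have "prodinf e = euler_const"
    unfolding euler_const_def e_def euler_factor_def ..
  finally show ?thesis .
qed

subsection \<open>The lower bound\<close>

text \<open>Two factors of 2 are given away: one for truncating the exponents at \<open>E\<close>,
  whence \<open>c_h h \<le> 2 * D\<close>, and one for the coprimality loss
  \<open>1 - 3 / P\<close>. Neither \<open>D\<close> nor \<open>M\<close> depends on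
  \<open>z\<close>.\<close>

lemma compatible_sums_ge:
  assumes "h > 0"
  obtains D M where "D > 0" "M > 0" "c_h h \<le> 2 * D"
    "\<And>z. \<exists>T \<subseteq> admissible {} h (z * M). D / 2 * ln (real z + 1) ^ 3 \<le> (\<Sum>t\<in>T. 1 / real (lcm3 t))"
proof -
  \<comment> \<open>At least 6 gives \<open>1 - 3 / P \<ge> 1/2\<close> and puts 2 among the small
    primes; at least \<open>h\<close> covers all prime factors of \<open>h\<close>.\<close>
  define P where "P = 6 + 2 * h"
  define Q where "Q = {p. prime p \<and> p \<le> P}"
  have Q: "finite Q" "\<forall>p\<in>Q. prime p"
    by (auto simp: Q_def)
  define lim where "lim = (\<lambda>p. (if p = 2 then 11 / 8 else 1) * f_pp p (multiplicity p h) * euler_factor p)"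
  have lim_pos: "(\<Prod>p\<in>Q. lim p) > 0"
    using Q assms by (intro prod_pos) (auto simp: lim_def f_pp_pos euler_factor_pos)
  have "(\<lambda>E. \<Prod>p\<in>Q. normalized_factor h E p) \<longlonglongrightarrow> (\<Prod>p\<in>Q. lim p)"
    unfolding lim_def using Q assms by (intro tendsto_prod normalized_factor_tendsto) auto
  hence "\<forall>\<^sub>F E in sequentially. (\<Prod>p\<in>Q. lim p) / 2 < (\<Prod>p\<in>Q. normalized_factor h E p)"
    using lim_pos by (intro order_tendstoD) auto
  then obtain E where E: "(\<Prod>p\<in>Q. lim p) / 2 < (\<Prod>p\<in>Q. normalized_factor h E p)"
    using eventually_happens'[OF sequentially_bot] by blast
  define D where "D = (\<Prod>p\<in>Q. normalized_factor h E p)"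
  define M where "M = (\<Prod>p\<in>Q. p ^ E)"
  have "(\<Prod>p\<in>Q. lim p) = 11 / 8 * f_mult h * (\<Prod>p\<in>Q. euler_factor p)"
  proof -
    have "2 \<in> Q"
      by (simp add: Q_def P_def)
    hence "(\<Prod>p\<in>Q. if p = 2 then 11 / 8 else 1 :: real) = 11 / 8"
      using Q by (simp add: prod.delta)
    moreover have "f_mult h = (\<Prod>p\<in>Q. f_pp p (multiplicity p h))"
      unfolding Q_def by (rule f_mult_eq) (use assms in \<open>auto simp: P_def\<close>)
    ultimately show ?thesis
      by (simp add: lim_def prod.distrib)
  qed
  moreover have "f_mult h \<ge> 0"
    unfolding f_mult_def using assms
    by (intro prod_nonneg less_imp_le f_pp_pos) (auto simp: in_prime_factors_iff)
  ultimately have "c_h h \<le> (\<Prod>p\<in>Q. lim p)"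
    unfolding c_h_def Q_def by (auto intro!: mult_left_mono euler_const_le)
  hence c: "c_h h \<le> 2 * D"
    using E by (simp add: D_def)
  have "\<exists>T \<subseteq> admissible {} h (z * M). D / 2 * ln (real z + 1) ^ 3 \<le> (\<Sum>t\<in>T. 1 / real (lcm3 t))" for z
  proof -
    define R where "R = rough Q z"
    define r where "r = (\<Sum>n\<in>R. 1 / real n)"
    have "coprime_triples R \<subseteq> admissible Q h z"
      by (auto simp: coprime_triples_def admissible_def compatible_def R_def coprime_iff_gcd_eq_1)
    then obtain T where T: "T \<subseteq> admissible {} h (z * M)"
      "(\<Sum>t\<in>T. 1 / real (lcm3 t)) = (\<Prod>p\<in>Q. local_factor h E p) * (\<Sum>t\<in>coprime_triples R. 1 / real (lcm3 t))"
      using adjoin_primes[OF Q assms] unfolding M_def by blast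
    have "(\<Prod>p\<in>Q. 1 - 1 / real p) \<ge> 0"
      using Q by (intro prod_nonneg) (auto dest!: bspec prime_gt_0_nat)
    hence "((\<Prod>p\<in>Q. 1 - 1 / real p) * ln (real z + 1)) ^ 3 \<le> r ^ 3"
      unfolding r_def R_def using Q by (intro power_mono sum_rough_ge mult_nonneg_nonneg) auto
    hence "1 / 2 * ((\<Prod>p\<in>Q. 1 - 1 / real p) * ln (real z + 1)) ^ 3 \<le> 1 / 2 * r ^ 3"
      by simp
    also have "\<dots> \<le> (1 - 3 / real P) * r ^ 3"
      by (intro mult_right_mono) (auto simp: P_def r_def field_simps intro!: sum_nonneg)
    also have "\<dots> \<le> (\<Sum>t\<in>coprime_triples R. 1 / real (lcm3 t))"
      unfolding r_def R_def Q_def by (intro sum_coprime_triples_ge) (simp add: P_def)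
    finally have "(\<Prod>p\<in>Q. local_factor h E p) * (1 / 2 * ((\<Prod>p\<in>Q. 1 - 1 / real p) * ln (real z + 1)) ^ 3)
        \<le> (\<Sum>t\<in>T. 1 / real (lcm3 t))"
      unfolding T(2)
      by (intro mult_left_mono prod_nonneg)
         (auto simp: local_factor_def intro: order_trans[OF zero_le_one local_sum_ge_1])
    moreover have "D = (\<Prod>p\<in>Q. 1 - 1 / real p) ^ 3 * (\<Prod>p\<in>Q. local_factor h E p)"
      by (simp add: D_def normalized_factor_def prod.distrib prod_power_distrib)
    ultimately show ?thesis
      using T(1) by (intro exI[of _ T]) (simp add: power_mult_distrib mult_ac)
  qed
  moreover have "D > 0"
    using E lim_pos unfolding D_def by linarith
  moreover have "M > 0"
    unfolding M_def using Q by (auto intro!: prod_pos simp: prime_gt_0_nat)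
  ultimately show ?thesis
    using that c by blast
qed

section \<open>Choice of parameters and final asymptotics\<close>

theorem theorem1p1:
  fixes h :: nat
  assumes "0 < h"
  shows "\<exists>C. \<forall>\<^sub>F x in at_top.
           S_sum x (int h) \<ge> c_h h / 27 * x * (ln x)^3 - C * x * (ln x)^2"
proof -
  obtain D M where DM: "D > 0" "M > 0" "c_h h \<le> 2 * D"
    and sums: "\<And>z. \<exists>T \<subseteq> admissible {} h (z * M). D / 2 * ln (real z + 1) ^ 3 \<le> (\<Sum>t\<in>T. 1 / real (lcm3 t))"
    using compatible_sums_ge[OF assms] by blast
  define H L where "H = real h" and "L = ln (real M)"
  \<comment> \<open>Chosen so that \<open>D * K * x\<close> is the loss \<open>8 * x\<close> from
    \<open>S_sum_ge\<close>.\<close>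
  define K where "K = 8 / D"
  \<comment> \<open>The right side has leading coefficient 4/27. The surplus over 2/27 absorbs the
    shift by \<open>L\<close>, the cut-off and the term \<open>K * x\<close>.\<close>
  have "\<forall>\<^sub>F x in at_top. 2 / 27 * x * ln x ^ 3 + K * x
      \<le> 4 * (x - 1 - H - x powr (2 / 3)) * (ln x / 3 - L) ^ 3"
  proof -
    have "((\<lambda>x. (4 * (x - 1 - H - x powr (2 / 3)) * (ln x / 3 - L) ^ 3 - K * x) / (x * ln x ^ 3))
        \<longlongrightarrow> 4 * (1 / 3) ^ 3) at_top"
      by real_asymp
    hence "\<forall>\<^sub>F x in at_top. 2 / 27
        < (4 * (x - 1 - H - x powr (2 / 3)) * (ln x / 3 - L) ^ 3 - K * x) / (x * ln x ^ 3)"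
      by (rule order_tendstoD) (simp add: power3_eq_cube)
    moreover have "\<forall>\<^sub>F x::real in at_top. x * ln x ^ 3 > 0"
      by real_asymp
    ultimately show ?thesis
    proof eventually_elim
      case (elim x)
      from elim(1) show ?case
        unfolding pos_less_divide_eq[OF elim(2)] by (simp add: mult.assoc)
    qed
  qed
  moreover have "\<forall>\<^sub>F x in at_top. x - 1 - H - x powr (2 / 3) \<ge> 0"
    by real_asymp
  moreover have "\<forall>\<^sub>F x in at_top. ln x / 3 - L \<ge> 0"
    by real_asymp
  moreover have "\<forall>\<^sub>F x in at_top. x \<ge> (1 :: real)"
    by real_asymp
  \<comment> \<open>That surplus allows the witness \<open>C = 0\<close>.\<close>
  ultimately have "\<forall>\<^sub>F x in at_top. S_sum x (int h) \<ge> c_h h / 27 * x * (ln x)^3 - 0 * x * (ln x)^2"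
  proof eventually_elim
    case (elim x)
    \<comment> \<open>\<open>Y ^ 3 \<le> x\<close> keeps the number of triples at most
      \<open>x\<close>; dividing by \<open>M\<close> keeps the entries at most \<open>Y\<close>
      after small primes are adjoined.\<close>
    define Y where "Y = nat \<lfloor>x powr (1 / 3)\<rfloor>"
    define z where "z = Y div M"
    have Y: "real Y \<le> x powr (1 / 3)" "x powr (1 / 3) < real Y + 1"
      unfolding Y_def by (simp_all add: of_nat_nat)
    have "real Y ^ 2 \<le> (x powr (1 / 3)) ^ 2" "real Y ^ 3 \<le> (x powr (1 / 3)) ^ 3"
      using Y(1) by (auto intro!: power_mono)
    hence Y2: "real Y ^ 2 \<le> x powr (2 / 3)" and Y3: "real Y ^ 3 \<le> x"
      using elim(4) by (simp_all add: powr_power)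
    obtain T where T: "T \<subseteq> admissible {} h (z * M)"
        "D / 2 * ln (real z + 1) ^ 3 \<le> (\<Sum>t\<in>T. 1 / real (lcm3 t))"
      using sums by blast
    have "z * M \<le> Y"
      by (simp add: z_def)
    hence T': "T \<subseteq> {1..Y} \<times> {1..Y} \<times> {1..Y}" "\<forall>t\<in>T. compatible h t"
      using T(1) by (fastforce simp: admissible_def rough_def)+
    \<comment> \<open>The \<open>+ 1\<close> inside the logarithm makes up for both roundings, so
      that \<open>(z + 1) * M\<close> reaches the cube root of \<open>x\<close>.\<close>
    have "Y < (z + 1) * M"
      using DM(2) dividend_less_div_times[of M Y] by (simp add: z_def algebra_simps)
    hence "real Y + 1 \<le> (real z + 1) * real M"
      by (metis Suc_leI of_nat_1 of_nat_Suc of_nat_add of_nat_le_iff of_nat_mult add.commute)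
    hence "x powr (1 / 3) \<le> (real z + 1) * real M"
      using Y(2) by linarith
    hence "ln (x powr (1 / 3)) \<le> ln ((real z + 1) * real M)"
      using elim(4) by (intro ln_mono) auto
    hence "ln x / 3 - L \<le> ln (real z + 1)"
      using elim(4) DM(2) by (simp add: ln_mult ln_powr L_def)
    hence "D / 2 * (ln x / 3 - L) ^ 3 \<le> D / 2 * ln (real z + 1) ^ 3"
      using elim(3) DM(1) by (intro mult_left_mono power_mono) auto
    also note T(2)
    finally have T_sum: "D / 2 * (ln x / 3 - L) ^ 3 \<le> (\<Sum>t\<in>T. 1 / real (lcm3 t))" .
    have "c_h h / 27 * x * (ln x)^3 - 0 * x * (ln x)^2 \<le> 2 * D / 27 * x * ln x ^ 3"
      using DM(3) elim(4) by (simp add: divide_right_mono mult_right_mono)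
    also have "\<dots> \<le> 8 * ((x - 1 - H - x powr (2 / 3)) * (D / 2 * (ln x / 3 - L) ^ 3) - x)"
      using mult_left_mono[OF elim(1), of D] DM(1) by (simp add: K_def algebra_simps)
    also have "\<dots> \<le> 8 * ((x - 1 - H - real Y ^ 2) * (\<Sum>t\<in>T. 1 / real (lcm3 t)) - x)"
    proof -
      have "(x - 1 - H - x powr (2 / 3)) * (D / 2 * (ln x / 3 - L) ^ 3)
          \<le> (x - 1 - H - real Y ^ 2) * (\<Sum>t\<in>T. 1 / real (lcm3 t))"
        using elim(2,3) Y2 T_sum DM(1) by (intro mult_mono) auto
      thus ?thesis
        by (intro mult_left_mono diff_right_mono) auto
    qed
    also have "\<dots> \<le> S_sum x (int h)"
      unfolding H_def using T' Y3 by (rule S_sum_ge)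
    finally show ?case .
  qed
  thus ?thesis ..
qed

end
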